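(* Let $U$ be a unary predicate, and for a finite $\{U\}$-structure $A$ let $A_0$ be the naked set (structure of the empty vocabulary) with universe $U^A$. Let $K$ be the class of all finite $\{U\}$-structures $A$ with $|A_0|!\le |A|$. There exists no relational machine that accepts all $A\in K$ with $|A_0|$ even and rejects all $A\in K$ with $|A_0|$ odd.
   Context: $|A|$ denotes the cardinality of the base set of $A$. A relational machine is a Turing machine augmented with a relational store, which is a structure of a fixed finite purely relational vocabulary $\Upsilon$; a part $\Upsilon_0\subseteq\Upsilon$ is devoted to the input relations (the input is a finite $\Upsilon_0$-structure; here $\Upsilon_0=\{U\}$). The Turing tape is initially empty (it carries no information about the input structure). The program consists of "if condition then action" instructions, which are ordinary Turing instructions except that (1) the condition may be augmented with the emptiness test of one of the relations, and (2) the action may be augmented with an algebraic operation on the relations whose result is assigned to a relation of the store: Boolean operations; projections $\pi_{i_1\dots i_m}R_k$ (project $R_k$ on the listed coordinates in the specified order); Cartesian product of two relations; selections $\sigma_{i=j}R_k$ (select the tuples of $R_k$ whose $i$-th and $j$-th components coincide). Arities are assumed appropriate. The machine accepts or rejects an input structure by reaching an accepting or rejecting control state. *)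

theory Defs
  imports Main "HOL-Library.Infinite_Typeclass"
begin

section \<open>Finite relational structures\<close>

record 'r vocabulary =
  symbols :: "'r set"
  arity :: "'r \<Rightarrow> nat"

text \<open>
  Tuples are lists. Only the symbols of the vocabulary at hand matter: the interpretation of
  any other symbol is junk and is never inspected.
\<close>

record ('a, 'r) rel_structure =
  universe :: "'a set"
  interp :: "'r \<Rightarrow> 'a list set"

definition tuples :: "'a set \<Rightarrow> nat \<Rightarrow> 'a list set" where
  "tuples A n = {xs. length xs = n \<and> set xs \<subseteq> A}"

definition finite_structure :: "'r vocabulary \<Rightarrow> ('a, 'r) rel_structure \<Rightarrow> bool" where
  "finite_structure V A \<longleftrightarrow>
     finite (universe A) \<and> (\<forall>R\<in>symbols V. interp A R \<subseteq> tuples (universe A) (arity V R))"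

definition structure_card :: "('a, 'r) rel_structure \<Rightarrow> nat" where
  "structure_card A = card (universe A)"


section \<open>Relational machines\<close>

text \<open>Coordinates in projections and selections are counted from 0.\<close>

datatype 'r rel_operation =
    Complement 'r
  | Union 'r 'r
  | Intersection 'r 'r
  | Difference 'r 'r
  | Projection "nat list" 'r
  | Product 'r 'r
  | Selection nat nat 'r

fun operation_result :: "'r vocabulary \<Rightarrow> ('a, 'r) rel_structure \<Rightarrow> 'r rel_operation \<Rightarrow> 'a list set"
  where
  "operation_result V A (Complement R) = tuples (universe A) (arity V R) - interp A R"
| "operation_result V A (Union R S) = interp A R \<union> interp A S"
| "operation_result V A (Intersection R S) = interp A R \<inter> interp A S"
| "operation_result V A (Difference R S) = interp A R - interp A S"
| "operation_result V A (Projection is R) = {map (\<lambda>i. xs ! i) is | xs. xs \<in> interp A R}"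
| "operation_result V A (Product R S) = {xs @ ys | xs ys. xs \<in> interp A R \<and> ys \<in> interp A S}"
| "operation_result V A (Selection i j R) = {xs \<in> interp A R. xs ! i = xs ! j}"

fun appropriate :: "'r vocabulary \<Rightarrow> 'r \<Rightarrow> 'r rel_operation \<Rightarrow> bool" where
  "appropriate V T (Complement R) \<longleftrightarrow> {T, R} \<subseteq> symbols V \<and> arity V T = arity V R"
| "appropriate V T (Union R S) \<longleftrightarrow>
     {T, R, S} \<subseteq> symbols V \<and> arity V T = arity V R \<and> arity V R = arity V S"
| "appropriate V T (Intersection R S) \<longleftrightarrow>
     {T, R, S} \<subseteq> symbols V \<and> arity V T = arity V R \<and> arity V R = arity V S"
| "appropriate V T (Difference R S) \<longleftrightarrow>
     {T, R, S} \<subseteq> symbols V \<and> arity V T = arity V R \<and> arity V R = arity V S"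
| "appropriate V T (Projection is R) \<longleftrightarrow>
     {T, R} \<subseteq> symbols V \<and> arity V T = length is \<and> (\<forall>i\<in>set is. i < arity V R)"
| "appropriate V T (Product R S) \<longleftrightarrow>
     {T, R, S} \<subseteq> symbols V \<and> arity V T = arity V R + arity V S"
| "appropriate V T (Selection i j R) \<longleftrightarrow>
     {T, R} \<subseteq> symbols V \<and> arity V T = arity V R \<and> i < arity V R \<and> j < arity V R"

datatype 'r emptiness_test = Is_Empty 'r | Is_Nonempty 'r

fun tested_symbol :: "'r emptiness_test \<Rightarrow> 'r" where
  "tested_symbol (Is_Empty R) = R"
| "tested_symbol (Is_Nonempty R) = R"

text \<open>Whether a test holds depends only on the set of relations that are currently empty.\<close>

fun test_holds :: "'r set \<Rightarrow> 'r emptiness_test option \<Rightarrow> bool" where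
  "test_holds E None \<longleftrightarrow> True"
| "test_holds E (Some (Is_Empty R)) \<longleftrightarrow> R \<in> E"
| "test_holds E (Some (Is_Nonempty R)) \<longleftrightarrow> R \<notin> E"

datatype head_move = Move_Left | Stay | Move_Right

fun move_head :: "head_move \<Rightarrow> int \<Rightarrow> int" where
  "move_head Move_Left p = p - 1"
| "move_head Stay p = p"
| "move_head Move_Right p = p + 1"

record ('q, 's, 'r) instruction =
  if_state :: 'q
  if_symbol :: 's
  if_test :: "'r emptiness_test option"
  then_state :: 'q
  then_symbol :: 's
  then_move :: head_move
  then_assign :: "('r \<times> 'r rel_operation) option"

record ('q, 's, 'r) relational_machine =
  store_vocabulary :: "'r vocabulary"
  input_symbols :: "'r set"
  states :: "'q set"
  tape_symbols :: "'s set"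
  blank :: 's
  start_state :: 'q
  accepting_states :: "'q set"
  rejecting_states :: "'q set"
  program :: "('q, 's, 'r) instruction set"

definition input_vocabulary :: "('q, 's, 'r) relational_machine \<Rightarrow> 'r vocabulary" where
  "input_vocabulary M = \<lparr>symbols = input_symbols M, arity = arity (store_vocabulary M)\<rparr>"

definition well_formed_instruction ::
  "('q, 's, 'r) relational_machine \<Rightarrow> ('q, 's, 'r) instruction \<Rightarrow> bool" where
  "well_formed_instruction M i \<longleftrightarrow>
     if_state i \<in> states M \<and> then_state i \<in> states M \<and>
     if_symbol i \<in> tape_symbols M \<and> then_symbol i \<in> tape_symbols M \<and>
     (\<forall>t. if_test i = Some t \<longrightarrow> tested_symbol t \<in> symbols (store_vocabulary M)) \<and>
     (\<forall>T e. then_assign i = Some (T, e) \<longrightarrow> appropriate (store_vocabulary M) T e)"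

definition deterministic_program :: "('q, 's, 'r) instruction set \<Rightarrow> bool" where
  "deterministic_program P \<longleftrightarrow>
     (\<forall>i\<in>P. \<forall>j\<in>P. \<forall>E. if_state i = if_state j \<and> if_symbol i = if_symbol j \<and>
        test_holds E (if_test i) \<and> test_holds E (if_test j) \<longrightarrow> i = j)"

definition well_formed_machine :: "('q, 's, 'r) relational_machine \<Rightarrow> bool" where
  "well_formed_machine M \<longleftrightarrow>
     finite (symbols (store_vocabulary M)) \<and> input_symbols M \<subseteq> symbols (store_vocabulary M) \<and>
     finite (states M) \<and> start_state M \<in> states M \<and>
     accepting_states M \<subseteq> states M \<and> rejecting_states M \<subseteq> states M \<and>
     accepting_states M \<inter> rejecting_states M = {} \<and>
     finite (tape_symbols M) \<and> blank M \<in> tape_symbols M \<and>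
     finite (program M) \<and> deterministic_program (program M) \<and>
     (\<forall>i\<in>program M. well_formed_instruction M i \<and>
        if_state i \<notin> accepting_states M \<union> rejecting_states M)"

text \<open>The tape is infinite in both directions.\<close>

record ('q, 's, 'a, 'r) configuration =
  control :: 'q
  tape :: "int \<Rightarrow> 's"
  head :: int
  store :: "('a, 'r) rel_structure"

definition initial_store ::
  "('q, 's, 'r) relational_machine \<Rightarrow> ('a, 'r) rel_structure \<Rightarrow> ('a, 'r) rel_structure" where
  "initial_store M A =
     \<lparr>universe = universe A, interp = (\<lambda>R. if R \<in> input_symbols M then interp A R else {})\<rparr>"

definition initial_configuration ::
  "('q, 's, 'r) relational_machine \<Rightarrow> ('a, 'r) rel_structure \<Rightarrow> ('q, 's, 'a, 'r) configuration"
  where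
  "initial_configuration M A =
     \<lparr>control = start_state M, tape = (\<lambda>_. blank M), head = 0, store = initial_store M A\<rparr>"

definition enabled :: "('q, 's, 'a, 'r) configuration \<Rightarrow> ('q, 's, 'r) instruction \<Rightarrow> bool" where
  "enabled c i \<longleftrightarrow>
     control c = if_state i \<and> tape c (head c) = if_symbol i \<and>
     test_holds {R. interp (store c) R = {}} (if_test i)"

definition updated_store ::
  "'r vocabulary \<Rightarrow> ('r \<times> 'r rel_operation) option \<Rightarrow> ('a, 'r) rel_structure \<Rightarrow>
     ('a, 'r) rel_structure" where
  "updated_store V a A =
     (case a of
        None \<Rightarrow> A
      | Some (T, e) \<Rightarrow> A\<lparr>interp := (interp A)(T := operation_result V A e)\<rparr>)"

definition successor ::
  "('q, 's, 'r) relational_machine \<Rightarrow> ('q, 's, 'r) instruction \<Rightarrow>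
     ('q, 's, 'a, 'r) configuration \<Rightarrow> ('q, 's, 'a, 'r) configuration" where
  "successor M i c =
     \<lparr>control = then_state i,
      tape = (tape c)(head c := then_symbol i),
      head = move_head (then_move i) (head c),
      store = updated_store (store_vocabulary M) (then_assign i) (store c)\<rparr>"

definition step ::
  "('q, 's, 'r) relational_machine \<Rightarrow> ('q, 's, 'a, 'r) configuration \<Rightarrow>
     ('q, 's, 'a, 'r) configuration \<Rightarrow> bool" where
  "step M c c' \<longleftrightarrow> (\<exists>i\<in>program M. enabled c i \<and> c' = successor M i c)"

definition accepts ::
  "('q, 's, 'r) relational_machine \<Rightarrow> ('a, 'r) rel_structure \<Rightarrow> bool" where
  "accepts M A \<longleftrightarrow>
     (\<exists>c. (step M)\<^sup>*\<^sup>* (initial_configuration M A) c \<and> control c \<in> accepting_states M)"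

definition rejects ::
  "('q, 's, 'r) relational_machine \<Rightarrow> ('a, 'r) rel_structure \<Rightarrow> bool" where
  "rejects M A \<longleftrightarrow>
     (\<exists>c. (step M)\<^sup>*\<^sup>* (initial_configuration M A) c \<and> control c \<in> rejecting_states M)"


section \<open>The class of padded sets\<close>

definition unary_vocabulary :: "'r \<Rightarrow> 'r vocabulary \<Rightarrow> bool" where
  "unary_vocabulary U V \<longleftrightarrow> symbols V = {U} \<and> arity V U = 1"

definition naked_set :: "'r \<Rightarrow> ('a, 'r) rel_structure \<Rightarrow> ('a, 'r) rel_structure" where
  "naked_set U A = \<lparr>universe = {x. [x] \<in> interp A U}, interp = (\<lambda>_. {})\<rparr>"

definition padded_sets :: "'r \<Rightarrow> ('a, 'r) rel_structure set" where
  "padded_sets U =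
     {A. finite_structure \<lparr>symbols = {U}, arity = (\<lambda>_. 1)\<rparr> A \<and>
         fact (structure_card (naked_set U A)) \<le> structure_card A}"

end

theory Submission
  imports Defs
begin

text \<open>
  Let \<open>k\<close> bound the arities of the store. In a run on a set with a distinguished subset \<open>P\<close>,
  every relation in the store is a union of types, where the type of a tuple records which of its
  entries coincide and which belong to \<open>P\<close>. If \<open>P\<close> and its complement both have at least \<open>k\<close>
  elements, then all types of at most \<open>k\<close> entries are realized and every realization extends,
  so the sets of types present evolve independently of the cardinalities. Hence the machine
  runs in lockstep on two such inputs whose subsets have consecutive sizes.
\<close>

section \<open>Partial maps preserving equality and the marked subset, and their extension\<close>

definition partial_embedding ::
  "'a set \<Rightarrow> 'a set \<Rightarrow> 'b set \<Rightarrow> 'b set \<Rightarrow> ('a \<Rightarrow> 'b) \<Rightarrow> 'a set \<Rightarrow> bool" where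
  "partial_embedding A P B Q f S \<longleftrightarrow>
     S \<subseteq> A \<and> f ` S \<subseteq> B \<and> inj_on f S \<and> (\<forall>x\<in>S. x \<in> P \<longleftrightarrow> f x \<in> Q)"

definition rich :: "nat \<Rightarrow> 'a set \<Rightarrow> 'a set \<Rightarrow> bool" where
  "rich k B Q \<longleftrightarrow> finite B \<and> k \<le> card (B \<inter> Q) \<and> k \<le> card (B - Q)"

lemma partial_embedding_subset:
  "partial_embedding A P B Q f S \<Longrightarrow> T \<subseteq> S \<Longrightarrow> partial_embedding A P B Q f T"
  unfolding partial_embedding_def by (auto intro: inj_on_subset)

lemma partial_embedding_inv_into:
  assumes "partial_embedding A P B Q f S"
  shows "partial_embedding B Q A P (inv_into S f) (f ` S)"
  using assms unfolding partial_embedding_def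
  by (auto simp: inj_on_inv_into)

text \<open>The image of \<open>x\<close> must lie on the side of \<open>Q\<close> that matches the
  side of \<open>P\<close> containing \<open>x\<close>. That side, \<open>C\<close> in the proof,
  has at least \<open>k\<close> points and \<open>f\<close> uses fewer than \<open>k\<close>, so a
  fresh one is left.\<close>

lemma partial_embedding_insert:
  assumes emb: "partial_embedding A P B Q f S"
    and rich: "rich k B Q" and "finite S" "card S < k" and x: "x \<in> A" "x \<notin> S"
  shows "\<exists>g. partial_embedding A P B Q g (insert x S) \<and> (\<forall>y\<in>S. g y = f y)"
proof -
  define C where "C = (if x \<in> P then B \<inter> Q else B - Q)"
  have "card (f ` S) < card C"
    using rich card_image_le[OF \<open>finite S\<close>, of f] \<open>card S < k\<close>
    by (auto simp: C_def rich_def)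
  then have "\<not> C \<subseteq> f ` S"
    using \<open>finite S\<close> by (meson card_mono finite_imageI leD)
  then obtain y where "y \<in> C" "y \<notin> f ` S"
    by blast
  then have "partial_embedding A P B Q (f(x := y)) (insert x S)"
    using emb x unfolding partial_embedding_def C_def inj_on_def
    by (auto split: if_splits)
  then show ?thesis
    using x by (intro exI[of _ "f(x := y)"]) auto
qed

text \<open>The points of \<open>T - S\<close> are added one at a time. Before each addition the
  domain is a proper subset of \<open>T\<close>, so it has fewer than \<open>k\<close> points and
  the one-point extension applies.\<close>

lemma partial_embedding_extend:
  assumes emb: "partial_embedding A P B Q f S" and rich: "rich k B Q"
    and T: "finite T" "S \<subseteq> T" "T \<subseteq> A" "card T \<le> k"
  shows "\<exists>g. partial_embedding A P B Q g T \<and> (\<forall>y\<in>S. g y = f y)"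
proof -
  have "\<exists>g. partial_embedding A P B Q g (S \<union> D) \<and> (\<forall>y\<in>S. g y = f y)"
    if "finite D" "D \<subseteq> T - S" for D
    using that
  proof (induction D rule: finite_induct)
    case empty
    then show ?case using emb by auto
  next
    case (insert x D)
    then obtain g where g: "partial_embedding A P B Q g (S \<union> D)" "\<forall>y\<in>S. g y = f y"
      by auto
    have "S \<union> D \<subset> T"
      using insert.hyps insert.prems T by auto
    then have "card (S \<union> D) < k" "finite (S \<union> D)"
      using T psubset_card_mono[of T "S \<union> D"] finite_subset[of "S \<union> D" T] by auto
    moreover have "x \<in> A" "x \<notin> S \<union> D"
      using insert.hyps insert.prems T by auto
    ultimately obtain h where "partial_embedding A P B Q h (insert x (S \<union> D))"
      "\<forall>y\<in>S \<union> D. h y = g y"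
      using partial_embedding_insert[OF g(1) rich] by blast
    with g(2) show ?case
      by (intro exI[of _ h]) auto
  qed
  from this[of "T - S"] show ?thesis
    using T by (simp add: Un_absorb1)
qed

section \<open>Stores containing the same types, and their preservation by the operations\<close>

definition transfers ::
  "'r vocabulary \<Rightarrow> 'a set \<Rightarrow> ('a, 'r) rel_structure \<Rightarrow> 'b set \<Rightarrow> ('b, 'r) rel_structure \<Rightarrow>
     bool" where
  "transfers V P s Q t \<longleftrightarrow>
     (\<forall>R\<in>symbols V. interp s R \<subseteq> tuples (universe s) (arity V R) \<and>
        (\<forall>xs\<in>interp s R. \<forall>f. partial_embedding (universe s) P (universe t) Q f (set xs) \<longrightarrow>
           map f xs \<in> interp t R))"

lemma transfers_tuple:
  "transfers V P s Q t \<Longrightarrow> R \<in> symbols V \<Longrightarrow> xs \<in> interp s R \<Longrightarrow>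
     length xs = arity V R \<and> set xs \<subseteq> universe s"
  unfolding transfers_def tuples_def by blast

lemma transfers_map:
  "transfers V P s Q t \<Longrightarrow> R \<in> symbols V \<Longrightarrow> xs \<in> interp s R \<Longrightarrow>
     partial_embedding (universe s) P (universe t) Q f (set xs) \<Longrightarrow> map f xs \<in> interp t R"
  unfolding transfers_def by blast

text \<open>The inverse of a partial embedding is a partial embedding, so transfer from
  \<open>t\<close> to \<open>s\<close> carries \<open>map f xs\<close> back to \<open>xs\<close>.
  This handles non-membership, which complement and difference require.\<close>

lemma transfers_map_reflects:
  assumes ts: "transfers V P t Q s" and R: "R \<in> symbols V"
    and emb: "partial_embedding (universe s) Q (universe t) P f (set xs)"
    and mem: "map f xs \<in> interp t R"
  shows "xs \<in> interp s R"
proof -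
  have "map (inv_into (set xs) f) (map f xs) \<in> interp s R"
    using transfers_map[OF ts R mem] partial_embedding_inv_into[OF emb] by simp
  moreover have "map (inv_into (set xs) f) (map f xs) = xs"
    using emb by (auto simp: partial_embedding_def intro!: map_idI)
  ultimately show ?thesis by simp
qed

lemma operation_result_tuples:
  assumes st: "transfers V P s Q t" and app: "appropriate V T e"
  shows "operation_result V s e \<subseteq> tuples (universe s) (arity V T)"
proof (cases e)
  case (Projection "is" R)
  show ?thesis
  proof
    fix zs assume "zs \<in> operation_result V s e"
    then obtain xs where "xs \<in> interp s R" and zs: "zs = map ((!) xs) is"
      using Projection by auto
    then have "length xs = arity V R" "set xs \<subseteq> universe s"
      using transfers_tuple[OF st] app Projection by auto
    then show "zs \<in> tuples (universe s) (arity V T)"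
      using app Projection by (force simp: zs tuples_def)
  qed
qed (use app transfers_tuple[OF st] in \<open>fastforce simp: tuples_def\<close>)+

text \<open>Transfer is assumed in both directions because complement and difference also use
  non-membership. Projection is the one case that calls on richness.\<close>

lemma operation_result_transfers:
  assumes st: "transfers V P s Q t" and ts: "transfers V Q t P s"
    and rich: "rich k (universe t) Q" and k: "\<forall>R\<in>symbols V. arity V R \<le> k"
    and app: "appropriate V T e" and zs: "zs \<in> operation_result V s e"
    and emb: "partial_embedding (universe s) P (universe t) Q f (set zs)"
  shows "map f zs \<in> operation_result V t e"
proof (cases e)
  case (Complement R)
  then have "zs \<notin> interp s R" "R \<in> symbols V" "zs \<in> tuples (universe s) (arity V R)"
    using zs app by auto
  then show ?thesis
    using Complement emb transfers_map_reflects[OF ts _ emb]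
    by (auto simp: tuples_def partial_embedding_def)
next
  case (Union R S)
  then show ?thesis
    using zs app transfers_map[OF st _ _ emb] by auto
next
  case (Intersection R S)
  then show ?thesis
    using zs app transfers_map[OF st _ _ emb] by auto
next
  case (Difference R S)
  then show ?thesis
    using zs app transfers_map[OF st _ _ emb] transfers_map_reflects[OF ts _ emb] by auto
next
  case (Projection "is" R)
  then obtain xs where xs: "xs \<in> interp s R" and zs_eq: "zs = map ((!) xs) is"
    using zs by auto
  have R: "R \<in> symbols V" and lt: "\<forall>i\<in>set is. i < arity V R"
    using app Projection by auto
  have len: "length xs = arity V R" and sub: "set xs \<subseteq> universe s"
    using transfers_tuple[OF st R xs] by auto
  have "set zs \<subseteq> set xs"
    using lt len by (auto simp: zs_eq)
  moreover have "card (set xs) \<le> k"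
    using card_length[of xs] len k R by fastforce
  \<comment> \<open>The map \<open>f\<close> is controlled only on the entries that survive the
    projection. It is extended to all entries of a preimage tuple \<open>xs\<close>, of which there
    are at most \<open>k\<close> because of the arity bound.\<close>
  ultimately obtain g where g: "partial_embedding (universe s) P (universe t) Q g (set xs)"
    and gf: "\<forall>y\<in>set zs. g y = f y"
    using partial_embedding_extend[OF emb rich _ _ sub] by auto
  have "map f zs = map ((!) (map g xs)) is"
    using gf lt len by (auto simp: zs_eq)
  then show ?thesis
    using transfers_map[OF st R xs g] Projection by auto
next
  case (Product R S)
  then obtain xs ys where "xs \<in> interp s R" "ys \<in> interp s S" and zs_eq: "zs = xs @ ys"
    using zs by auto
  moreover have "partial_embedding (universe s) P (universe t) Q f (set xs)"
    "partial_embedding (universe s) P (universe t) Q f (set ys)"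
    using emb by (auto simp: zs_eq intro: partial_embedding_subset)
  ultimately have "map f xs \<in> interp t R" "map f ys \<in> interp t S"
    using transfers_map[OF st] app Product by auto
  then show ?thesis
    using Product by (auto simp: zs_eq)
next
  case (Selection i j R)
  then have R: "R \<in> symbols V" and mem: "zs \<in> interp s R" and eq: "zs ! i = zs ! j"
    and lt: "i < arity V R" "j < arity V R"
    using zs app by auto
  then show ?thesis
    using Selection transfers_map[OF st R mem emb] transfers_tuple[OF st R mem] by auto
qed

lemma transfers_updated_store:
  assumes st: "transfers V P s Q t" and ts: "transfers V Q t P s"
    and rich: "rich k (universe t) Q" and k: "\<forall>R\<in>symbols V. arity V R \<le> k"
    and app: "\<forall>T e. a = Some (T, e) \<longrightarrow> appropriate V T e"
  shows "transfers V P (updated_store V a s) Q (updated_store V a t)"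
proof (cases a)
  case None
  then show ?thesis using st by (simp add: updated_store_def)
next
  case (Some Te)
  then obtain T e where a: "a = Some (T, e)"
    by (cases Te) auto
  then have app': "appropriate V T e"
    using app by blast
  show ?thesis
    using st operation_result_tuples[OF st app']
      operation_result_transfers[OF st ts rich k app']
    by (simp add: a updated_store_def transfers_def)
qed

lemma universe_updated_store [simp]: "universe (updated_store V a s) = universe s"
  by (simp add: updated_store_def split: option.split)

text \<open>The empty map is a partial embedding, so by richness it extends to the entries of any
  tuple in the relation, and that tuple is then transferred. This is why emptiness tests give the
  same answer on both sides.\<close>

lemma transfers_nonempty:
  assumes st: "transfers V P s Q t" and rich: "rich k (universe t) Q"
    and k: "\<forall>R\<in>symbols V. arity V R \<le> k"
    and R: "R \<in> symbols V" and ne: "interp s R \<noteq> {}"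
  shows "interp t R \<noteq> {}"
proof -
  obtain xs where xs: "xs \<in> interp s R"
    using ne by blast
  have len: "length xs = arity V R" and sub: "set xs \<subseteq> universe s"
    using transfers_tuple[OF st R xs] by auto
  have "card (set xs) \<le> k"
    using card_length[of xs] len k R by fastforce
  moreover have "partial_embedding (universe s) P (universe t) Q undefined {}"
    by (simp add: partial_embedding_def)
  ultimately obtain g where "partial_embedding (universe s) P (universe t) Q g (set xs)"
    using partial_embedding_extend[OF _ rich _ _ sub, of P undefined "{}"] by auto
  then show ?thesis
    using transfers_map[OF st R xs] by blast
qed

section \<open>Simultaneous runs on two rich inputs\<close>

definition lockstep ::
  "'r vocabulary \<Rightarrow> nat \<Rightarrow> 'a set \<Rightarrow> ('q, 's, 'a, 'r) configuration \<Rightarrow> 'b set \<Rightarrow>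
     ('q, 's, 'b, 'r) configuration \<Rightarrow> bool" where
  "lockstep V k P c Q d \<longleftrightarrow>
     control c = control d \<and> tape c = tape d \<and> head c = head d \<and>
     rich k (universe (store c)) P \<and> rich k (universe (store d)) Q \<and>
     transfers V P (store c) Q (store d) \<and> transfers V Q (store d) P (store c)"

text \<open>The instruction executed at \<open>c\<close> is enabled at \<open>d\<close> as well,
  since its condition sees only the control state, the scanned symbol and the emptiness of a store
  relation. Richness persists because the universe never changes.\<close>

lemma lockstep_step:
  assumes wf: "well_formed_machine M" and V: "V = store_vocabulary M"
    and k: "\<forall>R\<in>symbols V. arity V R \<le> k"
    and sim: "lockstep V k P c Q d" and step: "step M c c'"
  shows "\<exists>d'. step M d d' \<and> lockstep V k P c' Q d'"
proof -
  obtain i where i: "i \<in> program M" "enabled c i" and c': "c' = successor M i c"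
    using step by (auto simp: step_def)
  have wfi: "well_formed_instruction M i"
    using wf i by (auto simp: well_formed_machine_def)
  have cd: "control c = control d" "tape c = tape d" "head c = head d"
    and rc: "rich k (universe (store c)) P" and rd: "rich k (universe (store d)) Q"
    and tr: "transfers V P (store c) Q (store d)" "transfers V Q (store d) P (store c)"
    using sim by (auto simp: lockstep_def)
  \<comment> \<open>Agreement is available only for symbols of \<open>V\<close>; well-formedness
    guarantees that tests mention no others.\<close>
  have same: "interp (store c) R = {} \<longleftrightarrow> interp (store d) R = {}" if "R \<in> symbols V" for R
    using transfers_nonempty[OF tr(1) rd k that] transfers_nonempty[OF tr(2) rc k that] by blast
  have "enabled d i"
  proof (cases "if_test i")
    case None
    then show ?thesis using i cd by (simp add: enabled_def)
  next
    case (Some t)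
    then have "tested_symbol t \<in> symbols V"
      using wfi by (auto simp: well_formed_instruction_def V)
    then show ?thesis
      using i cd same Some by (cases t) (auto simp: enabled_def)
  qed
  moreover have app: "\<forall>T e. then_assign i = Some (T, e) \<longrightarrow> appropriate V T e"
    using wfi by (auto simp: well_formed_instruction_def V)
  have "lockstep V k P c' Q (successor M i d)"
    using cd rc rd transfers_updated_store[OF tr rd k app]
      transfers_updated_store[OF tr(2,1) rc k app]
    by (simp add: c' lockstep_def successor_def V)
  ultimately show ?thesis
    using i by (auto simp: step_def)
qed

lemma lockstep_steps:
  assumes "(step M)\<^sup>*\<^sup>* c c'"
    and "well_formed_machine M" "V = store_vocabulary M" "\<forall>R\<in>symbols V. arity V R \<le> k"
    and "lockstep V k P c Q d"
  shows "\<exists>d'. (step M)\<^sup>*\<^sup>* d d' \<and> lockstep V k P c' Q d'"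
  using assms(1)
proof (induction rule: rtranclp_induct)
  case base
  then show ?case using assms(5) by blast
next
  case (step c' c'')
  then show ?case
    using lockstep_step[OF assms(2-4)] by (meson rtranclp.rtrancl_into_rtrancl)
qed

section \<open>Determinism excludes both accepting and rejecting\<close>

lemma step_deterministic:
  assumes "well_formed_machine M" "step M c c'" "step M c c''"
  shows "c' = c''"
proof -
  obtain i j where "i \<in> program M" "enabled c i" "c' = successor M i c"
    "j \<in> program M" "enabled c j" "c'' = successor M j c"
    using assms by (auto simp: step_def)
  \<comment> \<open>The set \<open>E\<close> in \<open>deterministic_program\<close> is taken to be
    the set of relations empty in the store of \<open>c\<close>.\<close>
  moreover from this have "i = j"
    using assms(1) unfolding well_formed_machine_def deterministic_program_def enabled_def
    by metis
  ultimately show ?thesis by simp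
qed

text \<open>Induction along the run to \<open>d\<close>: while that run continues, the run to
  \<open>e\<close> cannot have stopped, since \<open>e\<close> halts, and by determinism it takes
  the same step. Once \<open>d\<close> is reached, no further step is possible.\<close>

lemma halting_configuration_unique:
  assumes "(step M)\<^sup>*\<^sup>* c d" "(step M)\<^sup>*\<^sup>* c e" "well_formed_machine M"
    and "\<nexists>d'. step M d d'" "\<nexists>e'. step M e e'"
  shows "d = e"
  using assms(1,2,4)
proof (induction rule: converse_rtranclp_induct)
  case base
  then show ?case by (metis converse_rtranclpE)
next
  case (step c c')
  then have "(step M)\<^sup>*\<^sup>* c' e"
    using assms(3,5) step_deterministic by (metis converse_rtranclpE)
  then show ?case using step by blast
qed

lemma final_state_halts:
  assumes "well_formed_machine M" "control c \<in> accepting_states M \<union> rejecting_states M"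
  shows "\<nexists>c'. step M c c'"
  using assms by (auto simp: well_formed_machine_def step_def enabled_def)

lemma not_accepts_and_rejects:
  assumes wf: "well_formed_machine M" and acc: "accepts M A" and rej: "rejects M A"
  shows False
proof -
  obtain c d where
    c: "(step M)\<^sup>*\<^sup>* (initial_configuration M A) c" "control c \<in> accepting_states M" and
    d: "(step M)\<^sup>*\<^sup>* (initial_configuration M A) d" "control d \<in> rejecting_states M"
    using acc rej by (auto simp: accepts_def rejects_def)
  then have "c = d"
    using halting_configuration_unique[OF c(1) d(1) wf] final_state_halts[OF wf] by blast
  then show False
    using c d wf by (auto simp: well_formed_machine_def)
qed

section \<open>Padded inputs and the contradiction\<close>

definition marked_set :: "'r \<Rightarrow> 'a set \<Rightarrow> 'a set \<Rightarrow> ('a, 'r) rel_structure" where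
  "marked_set U A P = \<lparr>universe = A, interp = (\<lambda>R. if R = U then {[x] | x. x \<in> P} else {})\<rparr>"

lemma structure_card_naked_marked_set [simp]:
  "structure_card (naked_set U (marked_set U A P)) = card P"
  by (simp add: structure_card_def naked_set_def marked_set_def)

lemma marked_set_padded:
  "finite A \<Longrightarrow> P \<subseteq> A \<Longrightarrow> fact (card P) \<le> card A \<Longrightarrow> marked_set U A P \<in> padded_sets U"
  by (auto simp: padded_sets_def finite_structure_def tuples_def)
    (auto simp: marked_set_def structure_card_def)

lemma universe_initial_store_marked_set [simp]:
  "universe (initial_store M (marked_set U A P)) = A"
  by (simp add: initial_store_def marked_set_def)

text \<open>Initially \<open>U\<close> alone can be nonempty, and it holds exactly the marked
  points, which partial embeddings respect.\<close>

lemma transfers_initial_store: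
  assumes "unary_vocabulary U (input_vocabulary M)" "P \<subseteq> A"
  shows "transfers (store_vocabulary M) P (initial_store M (marked_set U A P))
           Q (initial_store M (marked_set U B Q))"
  using assms
  by (auto simp: transfers_def initial_store_def marked_set_def unary_vocabulary_def
      input_vocabulary_def tuples_def partial_embedding_def)

lemma accepts_marked_set:
  assumes wf: "well_formed_machine M" and U: "unary_vocabulary U (input_vocabulary M)"
    and k: "\<forall>R\<in>symbols (store_vocabulary M). arity (store_vocabulary M) R \<le> k"
    and A: "rich k A P" "P \<subseteq> A" and B: "rich k B Q" "Q \<subseteq> B"
    and acc: "accepts M (marked_set U A P)"
  shows "accepts M (marked_set U B Q)"
proof -
  have "lockstep (store_vocabulary M) k P (initial_configuration M (marked_set U A P))
          Q (initial_configuration M (marked_set U B Q))"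
    using A B transfers_initial_store[OF U A(2), where Q = Q and B = B]
      transfers_initial_store[OF U B(2), where Q = P and B = A]
    by (simp add: lockstep_def initial_configuration_def)
  moreover obtain c where "(step M)\<^sup>*\<^sup>* (initial_configuration M (marked_set U A P)) c"
    "control c \<in> accepting_states M"
    using acc by (auto simp: accepts_def)
  ultimately show ?thesis
    using lockstep_steps[OF _ wf refl k] unfolding accepts_def lockstep_def by metis
qed

theorem lemma9:
  fixes U :: 'r
  shows "\<not> (\<exists>M :: ('q, 's, 'r) relational_machine.
           well_formed_machine M \<and> unary_vocabulary U (input_vocabulary M) \<and>
           (\<forall>A :: ('a::infinite, 'r) rel_structure. A \<in> padded_sets U \<longrightarrow>
              (even (structure_card (naked_set U A)) \<longrightarrow> accepts M A) \<and>
              (odd (structure_card (naked_set U A)) \<longrightarrow> rejects M A)))"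
proof
  assume "\<exists>M :: ('q, 's, 'r) relational_machine.
           well_formed_machine M \<and> unary_vocabulary U (input_vocabulary M) \<and>
           (\<forall>A :: ('a::infinite, 'r) rel_structure. A \<in> padded_sets U \<longrightarrow>
              (even (structure_card (naked_set U A)) \<longrightarrow> accepts M A) \<and>
              (odd (structure_card (naked_set U A)) \<longrightarrow> rejects M A))"
  then obtain M :: "('q, 's, 'r) relational_machine" where
    wf: "well_formed_machine M" and U: "unary_vocabulary U (input_vocabulary M)" and
    decides: "\<And>A :: ('a, 'r) rel_structure. A \<in> padded_sets U \<Longrightarrow>
      (even (structure_card (naked_set U A)) \<longrightarrow> accepts M A) \<and>
      (odd (structure_card (naked_set U A)) \<longrightarrow> rejects M A)"
    by blast
  let ?V = "store_vocabulary M"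
  obtain k where k: "\<forall>R\<in>symbols ?V. arity ?V R \<le> k"
  proof
    have "finite (symbols ?V)"
      using wf by (simp add: well_formed_machine_def)
    then show "\<forall>R\<in>symbols ?V. arity ?V R \<le> Max (arity ?V ` symbols ?V)"
      by simp
  qed
  \<comment> \<open>Even, so that \<open>n\<close> and \<open>n + 1\<close> have opposite parity in
    the required order, and at least \<open>k\<close>, so that the marked subsets are large enough
    for richness.\<close>
  define n where "n = 2 * k"
  \<comment> \<open>The factorial pads the input whose marked subset has \<open>n + 1\<close>
    elements, and hence the smaller one too. The remaining summands make room for that subset and
    for \<open>k\<close> points outside it.\<close>
  define N :: nat where "N = fact (n + 1) + (n + 1) + k"
  \<comment> \<open>Both inputs share this universe; their marked subsets differ by a single
    element.\<close>
  obtain A :: "'a set" where A: "finite A" "card A = N"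
    using infinite_arbitrarily_large[OF infinite_UNIV] by blast
  obtain Q where Q: "Q \<subseteq> A" "card Q = n + 1"
    using obtain_subset_with_card_n[of "n + 1" A] A by (auto simp: N_def)
  obtain P where P: "P \<subseteq> Q" "card P = n"
    using obtain_subset_with_card_n[of n Q] Q by auto
  have PA: "P \<subseteq> A"
    using P Q by blast
  have rich: "rich k A P" "rich k A Q"
    using A P Q PA
    by (auto simp: rich_def N_def n_def Int_absorb1 card_Diff_subset finite_subset)
  have "fact n \<le> (fact (n + 1) :: nat)"
    by (rule fact_mono) simp
  then have pad: "marked_set U A P \<in> padded_sets U" "marked_set U A Q \<in> padded_sets U"
    using A P(2) Q PA by (auto intro!: marked_set_padded simp: N_def simp del: fact_Suc)
  have "accepts M (marked_set U A P)"
    using decides[OF pad(1)] P by (simp add: n_def)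
  then have "accepts M (marked_set U A Q)"
    using accepts_marked_set[OF wf U k rich(1) PA rich(2) Q(1)] by simp
  moreover have "rejects M (marked_set U A Q)"
    using decides[OF pad(2)] Q by (simp add: n_def)
  ultimately show False
    using not_accepts_and_rejects[OF wf] by blast
qed

end
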